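(* Let $P=\Lambda^{\Psi}$ be a real number with $1\le P<\infty$. Then the $\theta$-Lebesgue sequence space $\ell_{P}(\mathbb{N})$, equipped with the norm $\|\cdot\|_{\ell_P}$, is a Banach space.
   Context: Let $S,T$ be compact (Hausdorff) spaces, let $C(S)$, $C(T)$ be the spaces of real-valued continuous functions on them, and let $\omega: C(S)\times C(T)\to\mathbb{R}$ be a bounded bilinear form. Fix sequences $(\alpha_k)_{k\in\mathbb{N}}$ in $C(S)$ and $(\beta_k)_{k\in\mathbb{N}}$ in $C(T)$. The exponent is written $\Lambda^{\Psi}=\Lambda(p)^{\Psi(p)}=\theta(p)$, the value of a strictly increasing function $\theta$ ranging between $1$ and $\infty$, with the argument $p$ suppressed; it is used only as a real number, here called $P$. For $1\le P<\infty$, the $\theta$-Lebesgue sequence space $\ell_P=\ell_P(\mathbb{N})$ is the set of all real sequences of the form $\mathbf{x}=\{\omega(\alpha_k,\beta_k)x_k\}_{k\in\mathbb{N}}$, with $x_k\in\mathbb{R}$, such that $\sum_{k=1}^{\infty}|\omega(\alpha_k,\beta_k)x_k|^{P}<\infty$. It is a subspace of the vector space of all real sequences (coordinatewise operations), with norm $$\|\mathbf{x}\|_{\ell_P}=\Big(\sum_{k=1}^{\infty}|\omega(\alpha_k,\beta_k)x_k|^{P}\Big)^{1/P}.$$ *)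

theory Defs
  imports "HOL-Analysis.Analysis" "HOL-Library.Function_Algebras"
begin

text \<open>
  The class \<open>banach\<close> speaks about whole types only. Here the Banach space is a linear
  subspace \<open>V\<close> of a real vector space, with a norm \<open>N\<close> that is meaningful on \<open>V\<close> only.
\<close>

locale normed_space_on = vector_space scale
  for scale :: "real \<Rightarrow> 'v::ab_group_add \<Rightarrow> 'v" +
  fixes V :: "'v set" and N :: "'v \<Rightarrow> real"
  assumes subspace_carrier: "subspace V"
    and norm_nonneg: "x \<in> V \<Longrightarrow> 0 \<le> N x"
    and norm_eq_0_iff: "x \<in> V \<Longrightarrow> N x = 0 \<longleftrightarrow> x = 0"
    and norm_scale: "x \<in> V \<Longrightarrow> N (scale c x) = \<bar>c\<bar> * N x"
    and norm_triangle: "x \<in> V \<Longrightarrow> y \<in> V \<Longrightarrow> N (x + y) \<le> N x + N y"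

locale banach_space_on = normed_space_on +
  assumes complete_carrier:
    "(\<And>n. X n \<in> V) \<Longrightarrow> (\<And>e. 0 < e \<Longrightarrow> \<exists>M. \<forall>m\<ge>M. \<forall>n\<ge>M. N (X m - X n) < e) \<Longrightarrow>
      \<exists>L\<in>V. (\<lambda>n. N (X n - L)) \<longlonglongrightarrow> 0"

definition seq_scale :: "real \<Rightarrow> (nat \<Rightarrow> real) \<Rightarrow> nat \<Rightarrow> real" where
  "seq_scale c x = (\<lambda>k. c * x k)"

text \<open>On a compact space \<open>'s\<close>, the type \<open>'s \<Rightarrow>\<^sub>C real\<close> consists of all continuous real functions.\<close>

definition theta_lebesgue ::
  "(('s::topological_space \<Rightarrow>\<^sub>C real) \<Rightarrow> ('t::topological_space \<Rightarrow>\<^sub>C real) \<Rightarrow> real) \<Rightarrow>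
    (nat \<Rightarrow> 's \<Rightarrow>\<^sub>C real) \<Rightarrow> (nat \<Rightarrow> 't \<Rightarrow>\<^sub>C real) \<Rightarrow> real \<Rightarrow> (nat \<Rightarrow> real) set" where
  "theta_lebesgue \<omega> \<alpha> \<beta> P =
    {(\<lambda>k. \<omega> (\<alpha> k) (\<beta> k) * x k) | x. summable (\<lambda>k. \<bar>\<omega> (\<alpha> k) (\<beta> k) * x k\<bar> powr P)}"

text \<open>
  The argument \<open>y\<close> is the sequence of products \<open>\<omega> (\<alpha> k) (\<beta> k) * x k\<close> itself, so the norm does
  not depend on the choice of \<open>x\<close>, which is not unique when a weight vanishes.
\<close>

definition theta_norm :: "real \<Rightarrow> (nat \<Rightarrow> real) \<Rightarrow> real" where
  "theta_norm P y = (\<Sum>k. \<bar>y k\<bar> powr P) powr (1 / P)"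

end

theory Submission
  imports Defs
begin

text \<open>
  The triangle inequality is Minkowski's, obtained from convexity of \<open>t powr P\<close> alone: with
  \<open>a = \<parallel>x\<parallel>\<close> and \<open>b = \<parallel>y\<parallel>\<close>, the sum \<open>\<bar>x k\<bar> + \<bar>y k\<bar>\<close> is \<open>a + b\<close> times a convex
  combination of \<open>\<bar>x k\<bar> / a\<close> and \<open>\<bar>y k\<bar> / b\<close>. For completeness, the coordinatewise limit of a Cauchy
  sequence inherits the Cauchy bound on each partial sum. The weights \<open>\<omega> (\<alpha> k) (\<beta> k)\<close> only
  prescribe which coordinates vanish, a condition stable under linear combinations and
  coordinatewise limits.
\<close>

text \<open>Convexity on the positive half-line extends to the endpoint 0, where the inequality
  reduces to \<open>t powr P \<le> t\<close> for \<open>0 < t < 1\<close>. The endpoint matters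
  because sequences may have zero coordinates.\<close>

lemma convex_on_powr_nonneg:
  assumes "1 \<le> P"
  shows "convex_on {0..} (\<lambda>t::real. t powr P)"
proof (rule convex_on_linorderI)
  fix t x y :: real
  assume t: "0 < t" "t < 1" and xy: "x \<in> {0..}" "y \<in> {0..}" "x < y"
  show "((1 - t) *\<^sub>R x + t *\<^sub>R y) powr P \<le> (1 - t) * x powr P + t * y powr P"
  proof (cases "x = 0")
    case True
    have "t powr P \<le> t"
      using powr_mono'[of 1 P t] t assms by simp
    then have "t powr P * y powr P \<le> t * y powr P"
      by (intro mult_right_mono) auto
    then show ?thesis
      using True t xy by (simp add: powr_mult)
  next
    case False
    then show ?thesis
      using t xy by (intro convex_onD[OF powr_convex[OF assms]]) auto
  qed
qed simp

text \<open>Convexity at the points \<open>u / a\<close> and \<open>v / b\<close> with weights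
  \<open>a / (a + b)\<close> and \<open>b / (a + b)\<close>, scaled back by \<open>a + b\<close>.
  The right-hand side is linear in \<open>u powr P\<close> and \<open>v powr P\<close>, so it can be
  summed over coordinates.\<close>

lemma powr_add_convex_bound:
  fixes a b u v P :: real
  assumes "1 \<le> P" "0 < a" "0 < b" "0 \<le> u" "0 \<le> v"
  shows "(u + v) powr P \<le>
    (a + b) powr P * (a / (a + b) * (u powr P / a powr P) + b / (a + b) * (v powr P / b powr P))"
proof -
  have "convex_on {0..} (\<lambda>t::real. t powr P)"
    using assms(1) by (rule convex_on_powr_nonneg)
  then have *: "((1 - b / (a + b)) *\<^sub>R (u / a) + (b / (a + b)) *\<^sub>R (v / b)) powr P
      \<le> (1 - b / (a + b)) * (u / a) powr P + b / (a + b) * (v / b) powr P"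
    using assms by (intro convex_onD) auto
  have 1: "1 - b / (a + b) = a / (a + b)"
    using assms by (simp add: field_simps)
  have "(u + v) powr P = ((a + b) * ((a / (a + b)) *\<^sub>R (u / a) + (b / (a + b)) *\<^sub>R (v / b))) powr P"
    using assms by (simp add: distrib_left)
  also have "\<dots> = (a + b) powr P * ((a / (a + b)) *\<^sub>R (u / a) + (b / (a + b)) *\<^sub>R (v / b)) powr P"
    by (rule powr_mult)
  also have "\<dots> \<le> (a + b) powr P * (a / (a + b) * (u / a) powr P + b / (a + b) * (v / b) powr P)"
    using * unfolding 1 by (intro mult_left_mono) auto
  finally show ?thesis
    using assms by (simp add: powr_divide)
qed

lemma theta_norm_nonneg: "0 \<le> theta_norm P y"
  by (simp add: theta_norm_def)

lemma theta_norm_powr: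
  assumes "1 \<le> P" "summable (\<lambda>k. \<bar>y k\<bar> powr P)"
  shows "theta_norm P y powr P = (\<Sum>k. \<bar>y k\<bar> powr P)"
  using assms by (simp add: theta_norm_def powr_powr suminf_nonneg)

lemma partial_sum_le_theta_norm:
  assumes "1 \<le> P" "summable (\<lambda>k. \<bar>y k\<bar> powr P)"
  shows "(\<Sum>k<K. \<bar>y k\<bar> powr P) \<le> theta_norm P y powr P"
  unfolding theta_norm_powr[OF assms] using assms(2) by (intro sum_le_suminf) auto

text \<open>Converse to \<open>partial_sum_le_theta_norm\<close>. Since only finite sums enter the
  hypothesis, summability need not be known beforehand; the triangle inequality and completeness
  both obtain it from here.\<close>

lemma theta_norm_le:
  assumes "1 \<le> P" "0 \<le> e" and bound: "\<And>K. (\<Sum>k<K. \<bar>y k\<bar> powr P) \<le> e powr P"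
  shows "summable (\<lambda>k. \<bar>y k\<bar> powr P)" and "theta_norm P y \<le> e"
proof -
  show s: "summable (\<lambda>k. \<bar>y k\<bar> powr P)"
    by (rule summableI_nonneg_bounded[OF _ bound]) simp
  have "(\<Sum>k. \<bar>y k\<bar> powr P) \<le> e powr P"
    by (rule suminf_le_const[OF s bound])
  then have "theta_norm P y \<le> (e powr P) powr (1 / P)"
    unfolding theta_norm_def using s assms(1) by (intro powr_mono2) (auto intro: suminf_nonneg)
  then show "theta_norm P y \<le> e"
    using assms by (simp add: powr_powr)
qed

lemma abs_le_theta_norm:
  assumes "1 \<le> P" "summable (\<lambda>k. \<bar>y k\<bar> powr P)"
  shows "\<bar>y k\<bar> \<le> theta_norm P y"
proof -
  have "\<bar>y k\<bar> powr P \<le> (\<Sum>j<Suc k. \<bar>y j\<bar> powr P)"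
    by (simp add: sum_nonneg)
  also have "\<dots> \<le> theta_norm P y powr P"
    using assms by (rule partial_sum_le_theta_norm)
  \<comment> \<open>If \<open>\<bar>y k\<bar>\<close> exceeded the norm, strict monotonicity of the
    power would contradict this bound.\<close>
  finally show ?thesis
    using assms(1) powr_less_mono2[of P "theta_norm P y" "\<bar>y k\<bar>"] theta_norm_nonneg[of P y]
    by force
qed

lemma theta_norm_eq_0_iff:
  assumes "1 \<le> P" "summable (\<lambda>k. \<bar>y k\<bar> powr P)"
  shows "theta_norm P y = 0 \<longleftrightarrow> y = 0"
proof
  assume "theta_norm P y = 0"
  then show "y = 0"
    using abs_le_theta_norm[OF assms] by (auto simp: fun_eq_iff)
qed (simp add: theta_norm_def)

lemma theta_norm_scale:
  assumes "1 \<le> P" "summable (\<lambda>k. \<bar>y k\<bar> powr P)"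
  shows "summable (\<lambda>k. \<bar>seq_scale c y k\<bar> powr P)"
    and "theta_norm P (seq_scale c y) = \<bar>c\<bar> * theta_norm P y"
proof -
  have eq: "(\<lambda>k. \<bar>seq_scale c y k\<bar> powr P) = (\<lambda>k. \<bar>c\<bar> powr P * \<bar>y k\<bar> powr P)"
    by (simp add: seq_scale_def abs_mult powr_mult)
  show "summable (\<lambda>k. \<bar>seq_scale c y k\<bar> powr P)"
    unfolding eq using assms(2) by (rule summable_mult)
  show "theta_norm P (seq_scale c y) = \<bar>c\<bar> * theta_norm P y"
    unfolding theta_norm_def eq using assms
    by (simp add: suminf_mult powr_mult powr_powr suminf_nonneg)
qed

lemma theta_norm_triangle:
  assumes P: "1 \<le> P"
    and x: "summable (\<lambda>k. \<bar>x k\<bar> powr P)" and y: "summable (\<lambda>k. \<bar>y k\<bar> powr P)"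
  shows "summable (\<lambda>k. \<bar>(x + y) k\<bar> powr P)"
    and "theta_norm P (x + y) \<le> theta_norm P x + theta_norm P y"
proof -
  define a b where "a = theta_norm P x" and "b = theta_norm P y"
  have "summable (\<lambda>k. \<bar>(x + y) k\<bar> powr P) \<and> theta_norm P (x + y) \<le> a + b"
  \<comment> \<open>Normalising by \<open>a\<close> and \<open>b\<close> requires both to be
    positive; if one sequence is zero, the claim is immediate.\<close>
  proof (cases "x = 0 \<or> y = 0")
    case True
    then show ?thesis
      using x y by (auto simp: a_def b_def theta_norm_nonneg)
  next
    case False
    then have pos: "0 < a" "0 < b"
      using theta_norm_eq_0_iff[OF P x] theta_norm_eq_0_iff[OF P y]
        theta_norm_nonneg[of P x] theta_norm_nonneg[of P y]
      by (auto simp: a_def b_def)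
    have "(\<Sum>k<K. \<bar>(x + y) k\<bar> powr P) \<le> (a + b) powr P" for K
    proof -
      have "\<bar>(x + y) k\<bar> powr P \<le> (a + b) powr P *
          (a / (a + b) * (\<bar>x k\<bar> powr P / a powr P) + b / (a + b) * (\<bar>y k\<bar> powr P / b powr P))" for k
      proof -
        have "\<bar>(x + y) k\<bar> powr P \<le> (\<bar>x k\<bar> + \<bar>y k\<bar>) powr P"
          using P by (intro powr_mono2) auto
        also note powr_add_convex_bound[OF P pos, of "\<bar>x k\<bar>" "\<bar>y k\<bar>"]
        finally show ?thesis by simp
      qed
      then have "(\<Sum>k<K. \<bar>(x + y) k\<bar> powr P) \<le> (\<Sum>k<K. (a + b) powr P *
          (a / (a + b) * (\<bar>x k\<bar> powr P / a powr P) + b / (a + b) * (\<bar>y k\<bar> powr P / b powr P)))"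
        by (intro sum_mono)
      also have "\<dots> = (a + b) powr P * (a / (a + b) * ((\<Sum>k<K. \<bar>x k\<bar> powr P) / a powr P)
          + b / (a + b) * ((\<Sum>k<K. \<bar>y k\<bar> powr P) / b powr P))"
        by (simp only: sum.distrib sum_distrib_left[symmetric] sum_divide_distrib[symmetric])
      \<comment> \<open>By the choice of \<open>a\<close> and \<open>b\<close> as the norms, each
        normalised partial sum is at most 1.\<close>
      also have "\<dots> \<le> (a + b) powr P * (a / (a + b) * 1 + b / (a + b) * 1)"
        using pos partial_sum_le_theta_norm[OF P x, of K] partial_sum_le_theta_norm[OF P y, of K]
        by (intro mult_left_mono add_mono) (auto simp: a_def b_def)
      also have "\<dots> = (a + b) powr P"
        using pos by (simp add: add_divide_distrib[symmetric])
      finally show ?thesis .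
    qed
    then show ?thesis
      using theta_norm_le[OF P, of "a + b" "x + y"] pos by auto
  qed
  then show "summable (\<lambda>k. \<bar>(x + y) k\<bar> powr P)"
    and "theta_norm P (x + y) \<le> theta_norm P x + theta_norm P y"
    by (simp_all add: a_def b_def)
qed

text \<open>The link between \<open>theta_norm\<close> and partial sums presupposes summability, as
  \<open>suminf\<close> is unspecified on divergent series. This supplies it for the differences in
  the Cauchy condition.\<close>

lemma summable_powr_diff:
  fixes x y :: "nat \<Rightarrow> real"
  assumes "1 \<le> P" "summable (\<lambda>k. \<bar>x k\<bar> powr P)" "summable (\<lambda>k. \<bar>y k\<bar> powr P)"
  shows "summable (\<lambda>k. \<bar>(x - y) k\<bar> powr P)"
  using theta_norm_triangle(1)[OF assms(1,2), of "- y"] assms(3) by simp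

text \<open>Coordinatewise convergence is part of the conclusion because the prescribed zeros of the
  sequences \<open>X n\<close> must later pass to \<open>L\<close>.\<close>

lemma theta_norm_complete:
  fixes X :: "nat \<Rightarrow> nat \<Rightarrow> real"
  assumes P: "1 \<le> P" and X: "\<And>n. summable (\<lambda>k. \<bar>X n k\<bar> powr P)"
    and Cauchy: "\<And>e. 0 < e \<Longrightarrow> \<exists>M. \<forall>m\<ge>M. \<forall>n\<ge>M. theta_norm P (X m - X n) < e"
  obtains L where "summable (\<lambda>k. \<bar>L k\<bar> powr P)" "(\<lambda>n. theta_norm P (X n - L)) \<longlonglongrightarrow> 0"
    "\<And>k. (\<lambda>n. X n k) \<longlonglongrightarrow> L k"
proof -
  note diff = summable_powr_diff[OF P X X]
  have "convergent (\<lambda>n. X n k)" for k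
  proof -
    \<comment> \<open>Each coordinate of a difference is dominated by its norm, so completeness of
      the reals applies.\<close>
    have "Cauchy (\<lambda>n. X n k)"
    proof (rule CauchyI)
      fix e :: real assume "0 < e"
      then obtain M where "\<forall>m\<ge>M. \<forall>n\<ge>M. theta_norm P (X m - X n) < e"
        using Cauchy by blast
      moreover have "norm (X m k - X n k) \<le> theta_norm P (X m - X n)" for m n
        using abs_le_theta_norm[OF P diff, of m n k] unfolding real_norm_def minus_apply .
      ultimately show "\<exists>M. \<forall>m\<ge>M. \<forall>n\<ge>M. norm (X m k - X n k) < e"
        by (meson le_less_trans)
    qed
    then show ?thesis by (simp add: Cauchy_convergent_iff)
  qed
  then obtain L where L: "\<And>k. (\<lambda>n. X n k) \<longlonglongrightarrow> L k"
    unfolding convergent_def by metis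
  \<comment> \<open>Summability of \<open>X m - L\<close> has to be proved along with the bound,
    since that of \<open>L\<close> is not yet known. The strict Cauchy bound becomes weak in the
    limit.\<close>
  have close: "\<exists>M. \<forall>m\<ge>M. summable (\<lambda>k. \<bar>(X m - L) k\<bar> powr P) \<and> theta_norm P (X m - L) \<le> e"
    if "0 < e" for e
  proof -
    obtain M where M: "\<And>m n. M \<le> m \<Longrightarrow> M \<le> n \<Longrightarrow> theta_norm P (X m - X n) < e"
      using Cauchy[OF \<open>0 < e\<close>] by blast
    have "(\<Sum>k<K. \<bar>(X m - L) k\<bar> powr P) \<le> e powr P" if "M \<le> m" for m K
    \<comment> \<open>With \<open>m\<close> and \<open>K\<close> fixed, \<open>n\<close> tends to
      infinity inside a finite sum, so no interchange of limit and series is needed.\<close>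
    proof (rule LIMSEQ_le_const2)
      show "(\<lambda>n. \<Sum>k<K. \<bar>(X m - X n) k\<bar> powr P) \<longlonglongrightarrow> (\<Sum>k<K. \<bar>(X m - L) k\<bar> powr P)"
        \<comment> \<open>The limiting base may be 0; the power is still continuous there because
          the bases are nonnegative and \<open>P\<close> is positive.\<close>
        using P by (auto intro!: tendsto_sum tendsto_powr' tendsto_intros L)
      show "\<exists>N. \<forall>n\<ge>N. (\<Sum>k<K. \<bar>(X m - X n) k\<bar> powr P) \<le> e powr P"
      proof (intro exI allI impI)
        fix n assume "M \<le> n"
        have "(\<Sum>k<K. \<bar>(X m - X n) k\<bar> powr P) \<le> theta_norm P (X m - X n) powr P"
          by (rule partial_sum_le_theta_norm[OF P diff])
        also have "\<dots> \<le> e powr P"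
          using M[OF that \<open>M \<le> n\<close>] P theta_norm_nonneg by (intro powr_mono2) auto
        finally show "(\<Sum>k<K. \<bar>(X m - X n) k\<bar> powr P) \<le> e powr P" .
      qed
    qed
    then show ?thesis
      using theta_norm_le[OF P, of e "X m - L" for m] that by (meson less_imp_le)
  qed
  show thesis
  proof (rule that)
    \<comment> \<open>\<open>L\<close> is the difference of \<open>X M\<close> and
      \<open>X M - L\<close>; the tolerance 1 is arbitrary.\<close>
    obtain M where "summable (\<lambda>k. \<bar>(X M - L) k\<bar> powr P)"
      using close[of 1] by auto
    then show "summable (\<lambda>k. \<bar>L k\<bar> powr P)"
      using summable_powr_diff[OF P X, of "X M - L" M] by simp
    show "(\<lambda>n. theta_norm P (X n - L)) \<longlonglongrightarrow> 0"
    proof (rule LIMSEQ_I)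
      fix r :: real assume "0 < r"
      then obtain M where M: "\<And>m. M \<le> m \<Longrightarrow> theta_norm P (X m - L) \<le> r / 2"
        using close[of "r / 2"] by auto
      show "\<exists>M. \<forall>n\<ge>M. norm (theta_norm P (X n - L) - 0) < r"
        using M theta_norm_nonneg[of P] \<open>0 < r\<close> by (intro exI[of _ M]) fastforce
    qed
  qed (rule L)
qed

lemma mem_theta_lebesgue_iff:
  "y \<in> theta_lebesgue \<omega> \<alpha> \<beta> P \<longleftrightarrow>
    (\<forall>k. \<omega> (\<alpha> k) (\<beta> k) = 0 \<longrightarrow> y k = 0) \<and> summable (\<lambda>k. \<bar>y k\<bar> powr P)"
proof (intro iffI conjI)
  assume *: "(\<forall>k. \<omega> (\<alpha> k) (\<beta> k) = 0 \<longrightarrow> y k = 0) \<and> summable (\<lambda>k. \<bar>y k\<bar> powr P)"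
  \<comment> \<open>The quotient serves as the witness \<open>x k\<close>. Where the weight
    vanishes, division by zero yields 0, and \<open>y k\<close> is 0 as well.\<close>
  then have y: "\<omega> (\<alpha> k) (\<beta> k) * (y k / \<omega> (\<alpha> k) (\<beta> k)) = y k" for k
    by auto
  show "y \<in> theta_lebesgue \<omega> \<alpha> \<beta> P"
    unfolding theta_lebesgue_def
    by (intro CollectI exI[of _ "\<lambda>k. y k / \<omega> (\<alpha> k) (\<beta> k)"]) (simp only: y *)
qed (auto simp: theta_lebesgue_def)

lemma vector_space_seq_scale: "vector_space seq_scale"
  by unfold_locales (auto simp: seq_scale_def fun_eq_iff algebra_simps)

theorem theorem2:
  fixes \<omega> :: "('s::t2_space \<Rightarrow>\<^sub>C real) \<Rightarrow> ('t::t2_space \<Rightarrow>\<^sub>C real) \<Rightarrow> real"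
    and \<alpha> :: "nat \<Rightarrow> 's \<Rightarrow>\<^sub>C real"
    and \<beta> :: "nat \<Rightarrow> 't \<Rightarrow>\<^sub>C real"
    and P :: real
  assumes "compact (UNIV :: 's set)"
    and "compact (UNIV :: 't set)"
    and "bounded_bilinear \<omega>"
    and "1 \<le> P"
  shows "banach_space_on seq_scale (theta_lebesgue \<omega> \<alpha> \<beta> P) (theta_norm P)"
proof -
  note P = \<open>1 \<le> P\<close>
  let ?V = "theta_lebesgue \<omega> \<alpha> \<beta> P"
  interpret vector_space seq_scale by (rule vector_space_seq_scale)
  have sum: "summable (\<lambda>k. \<bar>y k\<bar> powr P)" if "y \<in> ?V" for y
    using that by (simp add: mem_theta_lebesgue_iff)
  show ?thesis
  proof
    show "subspace ?V"
    proof (rule subspaceI)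
      show "0 \<in> ?V" by (simp add: mem_theta_lebesgue_iff)
      show "x + y \<in> ?V" if "x \<in> ?V" "y \<in> ?V" for x y
        using that theta_norm_triangle(1)[OF P, of x y] by (simp add: mem_theta_lebesgue_iff)
      show "seq_scale c x \<in> ?V" if "x \<in> ?V" for c x
        using that theta_norm_scale(1)[OF P, of x c]
        by (simp add: mem_theta_lebesgue_iff) (simp add: seq_scale_def)
    qed
    show "0 \<le> theta_norm P x" for x
      by (rule theta_norm_nonneg)
    show "theta_norm P x = 0 \<longleftrightarrow> x = 0" if "x \<in> ?V" for x
      by (rule theta_norm_eq_0_iff[OF P sum[OF that]])
    show "theta_norm P (seq_scale c x) = \<bar>c\<bar> * theta_norm P x" if "x \<in> ?V" for c x
      by (rule theta_norm_scale(2)[OF P sum[OF that]])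
    show "theta_norm P (x + y) \<le> theta_norm P x + theta_norm P y" if "x \<in> ?V" "y \<in> ?V" for x y
      by (rule theta_norm_triangle(2)[OF P sum[OF that(1)] sum[OF that(2)]])
  next
    fix X :: "nat \<Rightarrow> nat \<Rightarrow> real"
    assume X: "\<And>n. X n \<in> ?V"
      and C: "\<And>e. 0 < e \<Longrightarrow> \<exists>M. \<forall>m\<ge>M. \<forall>n\<ge>M. theta_norm P (X m - X n) < e"
    obtain L where L: "summable (\<lambda>k. \<bar>L k\<bar> powr P)" "(\<lambda>n. theta_norm P (X n - L)) \<longlonglongrightarrow> 0"
      "\<And>k. (\<lambda>n. X n k) \<longlonglongrightarrow> L k"
      using theta_norm_complete[OF P sum[OF X] C] by blast
    \<comment> \<open>Completeness of the unweighted space gives \<open>L\<close>; membership in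
      \<open>?V\<close> further requires zeros at the vanishing weights, where \<open>L k\<close> is
      the limit of a sequence that is constantly 0.\<close>
    have "L k = 0" if "\<omega> (\<alpha> k) (\<beta> k) = 0" for k
    proof -
      have "X n k = 0" for n
        using X[of n] that by (simp add: mem_theta_lebesgue_iff)
      then show ?thesis
        using L(3)[of k] by (simp add: LIMSEQ_const_iff)
    qed
    with L show "\<exists>L\<in>?V. (\<lambda>n. theta_norm P (X n - L)) \<longlonglongrightarrow> 0"
      by (auto simp: mem_theta_lebesgue_iff)
  qed
qed

end
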